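(* Let $n\equiv 1\pmod 6$ be a positive integer and $H$ an abelian group of order $n^2+n+1$. Suppose $T_0,T_1\subseteq H$ are inverse-closed subsets with $e\in T_0$ and $k_0+k_1=2n+1$ such that $T_0T_1=H-e$ and $T_0^2+T_1^2=2H-T_0^{(2)}-T_1^{(2)}+2ne$ in $\mathbb{Z}[H]$. Then: (a) $|X_0|=\frac13(n-1)^2$, $|X_1|=n+2$, $|X_2|=2n-2$, $|X_3|=\frac23(n-1)^2$, and $|X_i|=0$ for $i>3$. (b) $T_1\cap T_0^{(3)}=\emptyset$, $\theta_0=0$ and $\Delta_0\subseteq T_1$. (c) With $u_0=|T_1^{(3)}\cap T_0|$, $u_1=|T_1^{(3)}\cap T_1|$, $\Delta_1^0=\Delta_1\cap T_0$, $\Delta_1^1=\Delta_1\cap T_1$, $\Delta_1^2=\Delta_1\setminus(T_0\cup T_1)$, we have $$\frac{2n^2-5n-4+\theta_1}{3}+2u_0+u_1+2|\Delta_1^1|+|\Delta_1^2|\le |Y_3|\le \frac{2n^2-2n-3}{3}+u_0+u_1+|\Delta_1^1|+|\Delta_1^2|,$$ and $$\frac{n^2-10n-3}{3}-u_0-u_1-|\Delta_1^1|-|\Delta_1^2|+\theta_1\le |Y_0|\le \frac{n^2-n+1-\theta_1}{3}.$$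
   Context: $H$ is written multiplicatively with identity $e$. $\mathbb{Z}[H]$ is the integral group ring; a (multi)subset $D$ of $H$ is identified with $\sum_{g\in D}g\in\mathbb{Z}[H]$, and $H$ also denotes $\sum_{h\in H}h$. For $A=\sum a_gg$ and $t\in\mathbb{Z}$, $A^{(t)}=\sum a_g g^t$. A subset $T$ is inverse-closed if $T^{(-1)}=T$. $k_0=|T_0|$, $k_1=|T_1|$, $\hat T=T_0+T_1$. When an element of $\mathbb{Z}[H]$ with nonnegative coefficients is intersected with or compared to a set, it means its support (set of elements with positive coefficient). $X_i$ (resp. $Y_i$) is the set of elements of $H$ whose coefficient in $\hat T^{(2)}T_0$ (resp. $\hat T^{(2)}T_1$) is exactly $i$. $\theta_0=|(T_0^2\setminus T_0^{(2)})\cap\hat T^{(4)}|$ and $\theta_1=\frac{|T_1\cap\hat T^{(2)}|}{2}+|(T_1^2\setminus(T_1^{(2)}\cup\{e\}))\cap\hat T^{(4)}|$ (supports). For $i=0,1$, $\Delta_i$ is the set of elements of $H$ having coefficient exactly $2$ in $T_i^{(3)}$. *)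

theory Defs
  imports Complex_Main "HOL-Library.Poly_Mapping"
begin

text \<open>
  The abelian group H is a type of class \<^class>\<open>ab_group_add\<close>, hence written additively: its
  identity e is 0, and the power of g with exponent t is the multiple t g. The integral group
  ring of H is the ring \<^typ>\<open>'a \<Rightarrow>\<^sub>0 int\<close>, whose product is the convolution product and in which
  the element e is 1.
\<close>

type_synonym 'a group_ring = "'a \<Rightarrow>\<^sub>0 int"

definition of_set :: "'a set \<Rightarrow> 'a group_ring" where
  "of_set D = (\<Sum>g\<in>D. Poly_Mapping.single g 1)"

definition int_mult :: "int \<Rightarrow> 'a::ab_group_add \<Rightarrow> 'a" where
  "int_mult t g = (if t \<ge> 0 then (((+) g) ^^ nat t) 0 else - (((+) g) ^^ nat (- t)) 0)"

text \<open>
  The element \<open>A\<^sup>(\<^sup>t\<^sup>)\<close>. Coefficients of elements of H with the same multiple by t are added up.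
\<close>

definition power_map :: "'a::ab_group_add group_ring \<Rightarrow> int \<Rightarrow> 'a group_ring" where
  "power_map A t =
    (\<Sum>g\<in>Poly_Mapping.keys A. Poly_Mapping.single (int_mult t g) (Poly_Mapping.lookup A g))"

definition inverse_closed :: "'a::ab_group_add set \<Rightarrow> bool" where
  "inverse_closed T \<longleftrightarrow> power_map (of_set T) (-1) = of_set T"

definition supp :: "'a group_ring \<Rightarrow> 'a set" where
  "supp A = {g. Poly_Mapping.lookup A g > 0}"

definition coeff_set :: "'a group_ring \<Rightarrow> nat \<Rightarrow> 'a set" where
  "coeff_set A i = {g. Poly_Mapping.lookup A g = int i}"

definition T_hat :: "'a set \<Rightarrow> 'a set \<Rightarrow> 'a group_ring" where
  "T_hat T0 T1 = of_set T0 + of_set T1"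

definition X_set :: "'a::ab_group_add set \<Rightarrow> 'a set \<Rightarrow> nat \<Rightarrow> 'a set" where
  "X_set T0 T1 i = coeff_set (power_map (T_hat T0 T1) 2 * of_set T0) i"

definition Y_set :: "'a::ab_group_add set \<Rightarrow> 'a set \<Rightarrow> nat \<Rightarrow> 'a set" where
  "Y_set T0 T1 i = coeff_set (power_map (T_hat T0 T1) 2 * of_set T1) i"

definition theta0 :: "'a::ab_group_add set \<Rightarrow> 'a set \<Rightarrow> nat" where
  "theta0 T0 T1 =
    card ((supp (of_set T0 ^ 2) - supp (power_map (of_set T0) 2))
          \<inter> supp (power_map (T_hat T0 T1) 4))"

definition theta1 :: "'a::ab_group_add set \<Rightarrow> 'a set \<Rightarrow> real" where
  "theta1 T0 T1 =
    real (card (T1 \<inter> supp (power_map (T_hat T0 T1) 2))) / 2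
    + real (card ((supp (of_set T1 ^ 2) - (supp (power_map (of_set T1) 2) \<union> {0}))
                  \<inter> supp (power_map (T_hat T0 T1) 4)))"

definition Delta :: "'a::ab_group_add set \<Rightarrow> 'a set" where
  "Delta T = coeff_set (power_map (of_set T) 3) 2"

end

theory Submission
  imports Defs
begin

text \<open>
  Parity and \<open>k\<^sub>0 k\<^sub>1 = n\<^sup>2 + n\<close> give \<open>k\<^sub>0 = n\<close> and \<open>k\<^sub>1 = n + 1\<close>. Let \<open>c\<close> be the coefficient function of
  \<open>T\<^sup>(\<^sup>2\<^sup>) T\<^sub>i\<close>, where \<open>T = T\<^sub>0 + T\<^sub>1\<close>. Multiplying the equation for \<open>T\<^sub>0\<^sup>2 + T\<^sub>1\<^sup>2\<close> by \<open>T\<^sub>i\<close> and using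
  \<open>T\<^sub>i\<^sup>3 \<equiv> T\<^sub>i\<^sup>(\<^sup>3\<^sup>)\<close> modulo 3 determines \<open>c\<close> modulo 3 from \<open>T\<^sub>0\<close>, \<open>T\<^sub>1\<close> and \<open>T\<^sub>i\<^sup>(\<^sup>3\<^sup>)\<close>; the coefficients of the
  latter are at most 2 because 9 does not divide the order of the group. The sum of \<open>c\<^sup>2\<close> is the
  coefficient of the identity in \<open>(T\<^sup>2)\<^sup>(\<^sup>2\<^sup>) T\<^sub>i\<^sup>2\<close>, which is known up to \<open>\<theta>\<^sub>i\<close>. Everything then follows by
  summing pointwise inequalities such as \<open>c\<^sup>2 - 3 c + 2 [3 does not divide c] \<ge> 0\<close>. For \<open>i = 0\<close> the
  sum is so small that all of them are equalities.
\<close>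

section \<open>Coefficients, sums and symmetry in the group ring of a finite group\<close>

abbreviation coeff :: "'a group_ring \<Rightarrow> 'a \<Rightarrow> int" where
  "coeff \<equiv> Poly_Mapping.lookup"

lemma sum_of_bool_card: "finite A \<Longrightarrow> (\<Sum>x\<in>A. of_bool (P x) :: int) = int (card {x \<in> A. P x})"
  by (induction A rule: finite_induct) (auto simp: Collect_conv_if2 card_insert_if intro!: arg_cong[where f = card])

lemma lookup_times:
  fixes A B :: "'a::{ab_group_add,finite} group_ring"
  shows "coeff (A * B) h = (\<Sum>x\<in>UNIV. coeff A x * coeff B (h - x))"
proof -
  have "Sum_any (\<lambda>q. (coeff B q when h = l + q)) = coeff B (h - l)" for l
  proof -
    have "(\<lambda>q. (coeff B q when h = l + q)) = (\<lambda>q. (coeff B q when q = h - l))"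
      by (auto simp: when_def fun_eq_iff)
    then show ?thesis by (simp only: Sum_any_when_equal)
  qed
  then show ?thesis
    by (simp add: lookup_mult Sum_any.expand_superset[of UNIV])
qed

lemma lookup_numeral_times:
  fixes A :: "'a::ab_group_add group_ring"
  shows "coeff (numeral k * A) h = numeral k * coeff A h"
proof -
  have "coeff (of_nat m * A) h = of_nat m * coeff A h" for m
    by (induction m) (auto simp: lookup_add algebra_simps)
  from this[of "numeral k"] show ?thesis by simp
qed

lemma lookup_of_nat_times:
  fixes A :: "'a::ab_group_add group_ring"
  shows "coeff (of_nat m * A) h = of_nat m * coeff A h"
  by (induction m) (auto simp: lookup_add algebra_simps)

lemma lookup_of_set: "coeff (of_set (D :: 'a::finite set)) g = of_bool (g \<in> D)"
  by (simp add: of_set_def lookup_sum lookup_single when_def)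

lemma keys_of_set: "Poly_Mapping.keys (of_set (D :: 'a::finite set)) = D"
  by (auto simp: in_keys_iff lookup_of_set)

lemma supp_of_set: "supp (of_set (D :: 'a::finite set)) = D"
  by (auto simp: supp_def lookup_of_set)

lemma power_map_of_set:
  "power_map (of_set (D :: 'a::{ab_group_add,finite} set)) t
    = (\<Sum>g\<in>D. Poly_Mapping.single (int_mult t g) 1)"
  by (simp add: power_map_def keys_of_set lookup_of_set)

lemma lookup_power_map_of_set:
  "coeff (power_map (of_set (D :: 'a::{ab_group_add,finite} set)) t) h
    = int (card {g \<in> D. int_mult t g = h})"
proof -
  have "coeff (power_map (of_set D) t) h = (\<Sum>g\<in>D. of_bool (int_mult t g = h))"
    by (simp add: power_map_of_set lookup_sum lookup_single when_def of_bool_def eq_commute[of h])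
  then show ?thesis by (simp only: sum_of_bool_card finite)
qed

lemma int_mult_simps:
  "int_mult (-1) g = - g" "int_mult 2 g = g + g" "int_mult 3 g = g + g + g"
  "int_mult 4 g = (g + g) + (g + g)"
  by (simp_all add: int_mult_def numeral_eq_Suc add.assoc)

lemma inverse_closed_uminus:
  assumes "inverse_closed (T :: 'a::{ab_group_add,finite} set)"
  shows "- x \<in> T \<longleftrightarrow> x \<in> T"
proof -
  have "coeff (power_map (of_set T) (-1)) x = coeff (of_set T) x"
    using assms by (simp add: inverse_closed_def)
  moreover have "{g \<in> T. - g = x} = (if - x \<in> T then {- x} else {})" by auto
  ultimately show ?thesis
    by (auto simp: lookup_power_map_of_set lookup_of_set int_mult_simps split: if_splits)
qed

lemma of_set_union: "A \<inter> B = {} \<Longrightarrow> of_set (A \<union> B :: 'a::finite set) = of_set A + of_set B"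
  by (simp add: of_set_def sum.union_disjoint)

lemma power_map_inj:
  assumes "inj_on (int_mult t) (D :: 'a::{ab_group_add,finite} set)"
  shows "power_map (of_set D) t = of_set (int_mult t ` D)"
  unfolding power_map_of_set by (simp add: of_set_def sum.reindex[OF assms])

lemma lookup_of_set_times:
  "coeff (of_set A * of_set B) h = int (card {x \<in> A. h - x \<in> (B :: 'a::{ab_group_add,finite} set)})"
proof -
  have "coeff (of_set A * of_set B) h = (\<Sum>x\<in>UNIV. of_bool (x \<in> A \<and> h - x \<in> B))"
    by (simp add: lookup_times lookup_of_set of_bool_conj)
  then show ?thesis by (simp add: sum_of_bool_card)
qed

lemma sum_shift:
  fixes f :: "'a::{ab_group_add,finite} \<Rightarrow> int"
  shows "(\<Sum>h\<in>UNIV. f (h - x)) = (\<Sum>h\<in>UNIV. f h)"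
  by (rule sum.reindex_bij_witness[of _ "\<lambda>h. h + x" "\<lambda>h. h - x"]) auto

lemma sum_lookup_times:
  fixes A B :: "'a::{ab_group_add,finite} group_ring"
  shows "(\<Sum>h\<in>UNIV. coeff (A * B) h) = (\<Sum>x\<in>UNIV. coeff A x) * (\<Sum>x\<in>UNIV. coeff B x)"
proof -
  have "(\<Sum>h\<in>UNIV. coeff (A * B) h) = (\<Sum>x\<in>UNIV. \<Sum>h\<in>UNIV. coeff A x * coeff B (h - x))"
    unfolding lookup_times by (rule sum.swap)
  also have "\<dots> = (\<Sum>x\<in>UNIV. coeff A x * (\<Sum>h\<in>UNIV. coeff B h))"
    by (simp add: sum_distrib_left[symmetric] sum_shift)
  finally show ?thesis by (simp add: sum_distrib_right)
qed

lemma sum_lookup_of_set: "(\<Sum>x\<in>UNIV. coeff (of_set (A :: 'a::finite set)) x) = int (card A)"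
  by (simp add: lookup_of_set sum_of_bool_card)

lemma lookup_UNIV_times:
  fixes A :: "'a::{ab_group_add,finite} group_ring"
  shows "coeff (of_set UNIV * A) h = (\<Sum>x\<in>UNIV. coeff A x)"
  unfolding lookup_times lookup_of_set
  by (simp, rule sum.reindex_bij_witness[of _ "\<lambda>x. h - x" "\<lambda>x. h - x"]) auto

text \<open>Turns the coefficient at the identity into an inner product of coefficient functions;
  for a symmetric factor times itself this is a sum of squares.\<close>

lemma lookup_times_zero_symmetric:
  fixes A B :: "'a::{ab_group_add,finite} group_ring"
  assumes "\<And>x. coeff B (- x) = coeff B x"
  shows "coeff (A * B) 0 = (\<Sum>x\<in>UNIV. coeff A x * coeff B x)"
  by (simp add: lookup_times assms)

lemma lookup_times_uminus:
  fixes A B :: "'a::{ab_group_add,finite} group_ring"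
  assumes "\<And>x. coeff A (- x) = coeff A x" "\<And>x. coeff B (- x) = coeff B x"
  shows "coeff (A * B) (- h) = coeff (A * B) h"
  unfolding lookup_times
proof (rule sum.reindex_bij_witness[of _ uminus uminus])
  fix x show "coeff A (- x) * coeff B (h - - x) = coeff A x * coeff B (- h - x)"
    using assms(2)[of "h + x"] by (simp add: assms(1))
qed auto

section \<open>Squares and cubes modulo 2 and 3\<close>

text \<open>The cross terms come in equal pairs. The remainder is kept as an explicit multiple
  \<open>2 * C\<close>, because all coefficients of such an element are even; the version for cubes
  has the same form.\<close>

lemma sum_power2_frobenius:
  "finite D \<Longrightarrow> \<exists>C :: 'a::comm_ring_1. (\<Sum>g\<in>D. f g)^2 = (\<Sum>g\<in>D. f g ^ 2) + 2 * C"
proof (induction D rule: finite_induct)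
  case (insert x F)
  then obtain C where "(\<Sum>g\<in>F. f g)^2 = (\<Sum>g\<in>F. f g ^ 2) + 2 * C" by blast
  with insert have "(\<Sum>g\<in>insert x F. f g)^2
      = (\<Sum>g\<in>insert x F. f g ^ 2) + 2 * (C + f x * (\<Sum>g\<in>F. f g))"
    by (simp add: power2_sum algebra_simps)
  then show ?case by blast
qed (auto intro: exI[of _ 0])

lemma sum_power3_frobenius:
  "finite D \<Longrightarrow> \<exists>C :: 'a::comm_ring_1. (\<Sum>g\<in>D. f g)^3 = (\<Sum>g\<in>D. f g ^ 3) + 3 * C"
proof (induction D rule: finite_induct)
  case (insert x F)
  let ?S = "\<Sum>g\<in>F. f g"
  from insert obtain C where "?S^3 = (\<Sum>g\<in>F. f g ^ 3) + 3 * C" by blast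
  moreover have "(f x + ?S)^3 = f x ^ 3 + ?S ^ 3 + 3 * (f x ^ 2 * ?S + f x * ?S ^ 2)"
    by (simp add: power3_eq_cube power2_eq_square algebra_simps)
  ultimately have "(\<Sum>g\<in>insert x F. f g)^3
      = (\<Sum>g\<in>insert x F. f g ^ 3) + 3 * (C + f x ^ 2 * ?S + f x * ?S ^ 2)"
    using insert by (simp add: algebra_simps)
  then show ?case by blast
qed (auto intro: exI[of _ 0])

lemma lookup_square_mod_2:
  fixes D :: "'a::{ab_group_add,finite} set"
  shows "coeff (of_set D ^ 2) h mod 2 = coeff (power_map (of_set D) 2) h mod 2"
proof -
  obtain C where "of_set D ^ 2 = (\<Sum>g\<in>D. Poly_Mapping.single g (1::int) ^ 2) + 2 * C"
    using sum_power2_frobenius[of D "\<lambda>g. Poly_Mapping.single g (1::int)"] by (auto simp: of_set_def)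
  then show ?thesis
    by (simp add: power_map_of_set int_mult_simps power2_eq_square mult_single lookup_add
        lookup_numeral_times)
qed

lemma lookup_cube_mod_3:
  fixes D :: "'a::{ab_group_add,finite} set"
  shows "coeff (of_set D ^ 3) h mod 3 = coeff (power_map (of_set D) 3) h mod 3"
proof -
  obtain C where "of_set D ^ 3 = (\<Sum>g\<in>D. Poly_Mapping.single g (1::int) ^ 3) + 3 * C"
    using sum_power3_frobenius[of D "\<lambda>g. Poly_Mapping.single g (1::int)"] by (auto simp: of_set_def)
  then show ?thesis
    by (simp add: power_map_of_set int_mult_simps power3_eq_cube mult_single lookup_add
        lookup_numeral_times)
qed

section \<open>Lagrange's theorem and small torsion\<close>

text \<open>The translates of \<open>L\<close> partition the group into blocks of equal
  size.\<close>

lemma card_subgroup_dvd: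
  fixes L :: "'a::{ab_group_add,finite} set"
  assumes "0 \<in> L" and diff: "\<And>x y. x \<in> L \<Longrightarrow> y \<in> L \<Longrightarrow> x - y \<in> L"
  shows "card L dvd card (UNIV :: 'a set)"
proof -
  let ?C = "range (\<lambda>x. (+) x ` L)"
  have mem: "(z \<in> (+) x ` L) = (z - x \<in> L)" for x z
    by (force simp: image_iff)
  have add: "x + y \<in> L" if "x \<in> L" "y \<in> L" for x y
    using diff[OF that(1) diff[OF assms(1) that(2)]] by simp
  have "card L * card ?C = card (\<Union>?C)"
  proof (rule card_partition)
    show "card c = card L" if "c \<in> ?C" for c
      using that by (auto simp: card_image)
    show "c1 \<inter> c2 = {}" if "c1 \<in> ?C" "c2 \<in> ?C" "c1 \<noteq> c2" for c1 c2
    proof (rule ccontr)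
      assume "c1 \<inter> c2 \<noteq> {}"
      with that obtain x y where xy: "c1 = (+) x ` L" "c2 = (+) y ` L"
        by blast
      with \<open>c1 \<inter> c2 \<noteq> {}\<close> obtain z where c: "z - x \<in> L" "z - y \<in> L"
        using mem by blast
      from diff[OF c(1,2)] diff[OF c(2,1)] have d: "y - x \<in> L" "x - y \<in> L" by auto
      have "w - x \<in> L \<longleftrightarrow> w - y \<in> L" for w
        using add[of "w - x" "x - y"] add[of "w - y" "y - x"] d by auto
      then have "c1 = c2" by (auto simp: xy mem set_eq_iff)
      with that show False by blast
    qed
  qed auto
  moreover have "\<Union>?C = UNIV" using assms(1) by force
  ultimately show ?thesis by (metis dvd_triv_left)
qed

text \<open>The difference of two distinct such elements would generate a subgroup of order
  2.\<close>

lemma double_inj: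
  assumes "odd (card (UNIV :: 'a::{ab_group_add,finite} set))" and "x + x = y + (y :: 'a)"
  shows "x = y"
proof (rule ccontr)
  assume "x \<noteq> y"
  define z where "z = x - y"
  have z: "z \<noteq> 0" "z + z = 0" using assms(2) \<open>x \<noteq> y\<close> by (auto simp: z_def algebra_simps)
  then have "- z = z" using minus_unique by blast
  then have "card {0, z} dvd card (UNIV :: 'a set)"
    using z by (intro card_subgroup_dvd) auto
  with z assms(1) show False by auto
qed

text \<open>A solution outside the subgroup generated by \<open>w\<close> would, together with
  \<open>w\<close>, generate a subgroup of order 9.\<close>

lemma three_torsion:
  assumes "\<not> 9 dvd card (UNIV :: 'a::{ab_group_add,finite} set)"
    and w: "w + w + w = (0 :: 'a)" "w \<noteq> 0" and v: "v + v + v = 0"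
  shows "v \<in> {0, w, w + w}"
proof (rule ccontr)
  assume nv: "v \<notin> {0, w, w + w}"
  let ?W = "{0, w, w + w}"
  have neg: "- w = w + w" "- v = v + v"
    using w(1) v by (simp_all add: neg_eq_iff_add_eq_0 add.assoc)
  have W2: "w + w \<noteq> w" "w + w \<noteq> 0" using w neg by auto
  have Wneg: "- x \<in> ?W" if "x \<in> ?W" for x using that neg w(1) by auto
  have Wadd: "x + y \<in> ?W" if "x \<in> ?W" "y \<in> ?W" for x y
    using that w(1) by (auto simp: add.assoc)
  have Wdiff: "x - y \<in> ?W" if "x \<in> ?W" "y \<in> ?W" for x y
    using Wadd[OF that(1) Wneg[OF that(2)]] by simp
  have nv2: "v + v \<notin> ?W" using Wneg[of "v + v"] nv neg(2) by (metis minus_minus)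
  \<comment> \<open>The sum of the subgroups generated by \<open>w\<close> and by \<open>v\<close>.
    It consists of three cosets of \<open>?W\<close>, which are disjoint because neither
    \<open>v\<close> nor \<open>v + v\<close> lies in \<open>?W\<close>.\<close>
  define L where "L = {x. \<exists>a\<in>?W. \<exists>j\<in>{0, v, v + v}. x = a + j}"
  have L_alt: "L = ?W \<union> (\<lambda>a. a + v) ` ?W \<union> (\<lambda>a. a + (v + v)) ` ?W"
    by (auto simp: L_def)
  have "card L dvd card (UNIV :: 'a set)"
  proof (rule card_subgroup_dvd)
    show "0 \<in> L" by (auto simp: L_def)
    fix x y assume "x \<in> L" "y \<in> L"
    then obtain a b i j where xy: "a \<in> ?W" "b \<in> ?W" "i \<in> {0, v, v + v}" "j \<in> {0, v, v + v}"
      "x = a + i" "y = b + j" unfolding L_def by blast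
    have "i - j \<in> {0, v, v + v}" using xy(3,4) neg(2) v by (auto simp: algebra_simps)
    moreover have "x - y = (a - b) + (i - j)" by (simp add: xy)
    ultimately show "x - y \<in> L" using Wdiff[OF xy(1,2)] unfolding L_def by blast
  qed
  moreover have "card L = 9"
  proof -
    have c: "card ?W = 3" "card ((\<lambda>a. a + v) ` ?W) = 3" "card ((\<lambda>a. a + (v + v)) ` ?W) = 3"
      using W2 w(2) by (auto simp: card_image)
    have d1: "?W \<inter> (\<lambda>a. a + v) ` ?W = {}"
    proof -
      have False if "a \<in> ?W" "b \<in> ?W" "a = b + v" for a b
        using Wdiff[OF that(1,2)] that(3) nv by simp
      then show ?thesis by blast
    qed
    have d2: "(?W \<union> (\<lambda>a. a + v) ` ?W) \<inter> (\<lambda>a. a + (v + v)) ` ?W = {}"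
    proof -
      have False if "a \<in> ?W" "b \<in> ?W" "a = b + (v + v)" for a b
        using Wdiff[OF that(1,2)] that(3) nv2 by simp
      moreover have False if "a \<in> ?W" "b \<in> ?W" "a + v = b + (v + v)" for a b
      proof -
        have "a - b = v" using that(3) by (simp add: algebra_simps)
        then show False using Wdiff[OF that(1,2)] nv by simp
      qed
      ultimately show ?thesis by blast
    qed
    show ?thesis unfolding L_alt
      using c d1 d2 by (simp only: card_Un_disjoint finite.intros finite_imageI finite_UnI)
  qed
  ultimately show False using assms(1) by simp
qed

section \<open>Squares of the two sets, in a setting symmetric in them\<close>

text \<open>Doubling is injective in a group of odd order, so \<open>power_map (of_set D) 2\<close>
  has coefficients 0 and 1 only and can be handled as this set.\<close>

abbreviation dbl :: "'a::ab_group_add set \<Rightarrow> 'a set" where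
  "dbl D \<equiv> (\<lambda>x. x + x) ` D"

text \<open>The assumptions are symmetric in \<open>A\<close> and \<open>B\<close>, and the position
  of the identity is left open. Hence \<open>swap\<close> provides each result for both
  sets.\<close>

locale lee_pair =
  fixes n :: nat and A B :: "'a::{ab_group_add,finite} set"
  assumes n_mod_6: "n mod 6 = 1"
    and card_UNIV: "card (UNIV :: 'a set) = n ^ 2 + n + 1"
    and inverse_closed_A: "inverse_closed A" and inverse_closed_B: "inverse_closed B"
    and card_sum: "card A + card B = 2 * n + 1"
    and product: "of_set A * of_set B = of_set UNIV - 1"
    and squares: "of_set A ^ 2 + of_set B ^ 2 =
           2 * of_set UNIV - power_map (of_set A) 2 - power_map (of_set B) 2 + of_nat (2 * n) * 1"
begin

lemma swap: "lee_pair n B A"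
proof (unfold_locales)
  show "of_set B * of_set A = of_set UNIV - 1" using product by (simp only: mult.commute)
  show "of_set B ^ 2 + of_set A ^ 2
      = 2 * of_set UNIV - power_map (of_set B) 2 - power_map (of_set A) 2 + of_nat (2 * n) * 1"
    using squares by (simp only: add.commute[of "of_set B ^ 2"]) simp
qed (use n_mod_6 card_UNIV inverse_closed_A inverse_closed_B card_sum in simp_all)

lemma odd_n: "odd n"
  using n_mod_6 by presburger

lemma odd_card_UNIV: "odd (card (UNIV :: 'a set))"
  by (simp add: card_UNIV odd_n)

lemma not_9_dvd_card_UNIV: "\<not> 9 dvd card (UNIV :: 'a set)"
proof -
  have "n = 3 * (n div 3) + 1" using n_mod_6 by presburger
  then obtain m where "n = 3 * m + 1" by blast
  then have "card (UNIV :: 'a set) = 9 * (m ^ 2 + m) + 3"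
    by (simp add: card_UNIV power2_eq_square algebra_simps)
  then show ?thesis by presburger
qed

lemma dbl_eq_iff [simp]: "x + x = y + y \<longleftrightarrow> x = (y :: 'a)"
  using double_inj[OF odd_card_UNIV] by blast

lemma dbl_eq_0_iff [simp]: "x + x = 0 \<longleftrightarrow> x = (0 :: 'a)"
  using dbl_eq_iff[of x 0] by simp

lemma dbl_mem_iff [simp]: "x + x \<in> dbl D \<longleftrightarrow> x \<in> (D :: 'a set)"
  by auto

lemma zero_mem_dbl_iff [simp]: "0 \<in> dbl D \<longleftrightarrow> 0 \<in> (D :: 'a set)"
  using dbl_mem_iff[of 0 D] by simp

lemma inj_dbl: "inj (\<lambda>x :: 'a. x + x)"
  by (rule injI) simp

lemma bij_dbl: "bij (\<lambda>x :: 'a. x + x)"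
  using inj_dbl finite_UNIV_inj_surj[OF finite inj_dbl] by (simp add: bij_def)

lemma dblE: obtains g :: 'a where "h = g + g"
  using bij_dbl by (metis bij_pointE)

lemma power_map_2: "power_map (of_set D) 2 = of_set (dbl D)" for D :: "'a set"
proof -
  have "int_mult 2 = (\<lambda>x :: 'a. x + x)" by (simp add: fun_eq_iff int_mult_simps)
  then show ?thesis using power_map_inj[of 2 D] inj_on_subset[OF inj_dbl, of D] by simp
qed

lemma power_map_4: "power_map (of_set D) 4 = of_set (dbl (dbl D))" for D :: "'a set"
proof -
  have "int_mult 4 = (\<lambda>x :: 'a. (x + x) + (x + x))" by (simp add: fun_eq_iff int_mult_simps)
  then show ?thesis using power_map_inj[of 4 D] by (simp add: inj_on_def image_image)
qed

lemma uminus_mem_A [simp]: "- x \<in> A \<longleftrightarrow> x \<in> A" and uminus_mem_B [simp]: "- x \<in> B \<longleftrightarrow> x \<in> B"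
  using inverse_closed_uminus inverse_closed_A inverse_closed_B by blast+

text \<open>A common element \<open>x\<close> would represent 0 as \<open>x + (- x)\<close>, but the
  product has coefficient 0 there.\<close>

lemma disjoint: "A \<inter> B = {}"
proof -
  have "coeff (of_set A * of_set B) 0 = 0" by (simp add: product lookup_minus lookup_of_set)
  then show ?thesis by (auto simp: lookup_of_set_times)
qed

lemma card_mult: "card A * card B = n ^ 2 + n"
proof -
  have "int (card A * card B) = (\<Sum>h\<in>UNIV. coeff (of_set A * of_set B) h)"
    by (simp add: sum_lookup_times sum_lookup_of_set)
  also have "\<dots> = int (n ^ 2 + n)"
    by (simp add: product lookup_minus sum_subtractf sum_lookup_of_set lookup_one card_UNIV when_def)
  finally show ?thesis by linarith
qed

lemma sq_nonneg: "coeff (of_set D ^ 2) h \<ge> 0" for D :: "'a set"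
  by (simp add: power2_eq_square lookup_of_set_times)

lemma sq_zero: "coeff (of_set A ^ 2) 0 = int (card A)"
  by (simp add: power2_eq_square lookup_of_set_times)

lemma sq_parity: "coeff (of_set A ^ 2) h mod 2 = of_bool (h \<in> dbl A)"
  using lookup_square_mod_2[of A h] by (simp add: power_map_2 lookup_of_set)

lemma sq_sum:
  "coeff (of_set A ^ 2) h + coeff (of_set B ^ 2) h
    = 2 - of_bool (h \<in> dbl A) - of_bool (h \<in> dbl B) + 2 * int n * of_bool (h = 0)"
proof -
  have "coeff (of_set A ^ 2 + of_set B ^ 2) h = coeff (2 * of_set UNIV
      - power_map (of_set A) 2 - power_map (of_set B) 2 + of_nat (2 * n) * 1) h"
    by (simp only: squares)
  then show ?thesis
    unfolding power_map_2 mult_1_right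
    by (simp add: lookup_add lookup_minus lookup_numeral_times lookup_of_set lookup_of_nat when_def
        del: of_nat_mult)
qed

text \<open>Away from 0 the two squares are nonnegative and add up to 1 on doubles of
  \<open>A\<close> and \<open>B\<close>, and to 2 elsewhere. The parity of the first square then
  leaves only these values.\<close>

lemma sq_cases:
  assumes "h \<noteq> 0"
  shows "coeff (of_set A ^ 2) h =
    (if h \<in> dbl A then 1 else if h \<in> supp (of_set A ^ 2) then 2 else 0)"
    and "h \<in> dbl B \<Longrightarrow> coeff (of_set A ^ 2) h = 0"
proof -
  have *: "coeff (of_set A ^ 2) h \<ge> 0" "coeff (of_set B ^ 2) h \<ge> 0"
    "coeff (of_set A ^ 2) h + coeff (of_set B ^ 2) h
      = 2 - of_bool (h \<in> dbl A) - of_bool (h \<in> dbl B)"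
    using sq_nonneg sq_sum[of h] assms by simp_all
  have "dbl A \<inter> dbl B = {}" using disjoint by auto
  then show "coeff (of_set A ^ 2) h =
    (if h \<in> dbl A then 1 else if h \<in> supp (of_set A ^ 2) then 2 else 0)"
    and "h \<in> dbl B \<Longrightarrow> coeff (of_set A ^ 2) h = 0"
    using * sq_parity[of h] by (auto simp: supp_def of_bool_def split: if_splits; presburger)+
qed

text \<open>By \<open>sq_cases\<close> the element \<open>z + z\<close> has just one representation
  as a sum of two elements of \<open>A\<close>, and that is \<open>z + z\<close> itself. So a
  nonzero \<open>z\<close> in \<open>A\<close> is the midpoint of no nontrivial pair from
  \<open>A\<close>.\<close>

lemma sq_dbl_unique:
  assumes "x \<in> A" "y \<in> A" "z \<in> A" "z \<noteq> 0" "x + y = z + z"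
  shows "x = z"
proof (rule ccontr)
  assume "x \<noteq> z"
  have "z + z - x = y" using assms(5) by (simp add: algebra_simps)
  then have "{x, z} \<subseteq> {x \<in> A. z + z - x \<in> A}" using assms by auto
  from card_mono[OF _ this] \<open>x \<noteq> z\<close> have "coeff (of_set A ^ 2) (z + z) \<ge> 2"
    by (simp add: power2_eq_square lookup_of_set_times)
  then show False using sq_cases(1)[of "z + z"] assms by simp
qed

text \<open>The mixed term is twice the known product. So the square of the union is explicit,
  although the two single squares are not.\<close>

lemma hat_sq:
  "coeff (of_set (A \<union> B) ^ 2) h
    = 4 - of_bool (h \<in> dbl (A \<union> B)) + (2 * int n - 2) * of_bool (h = 0)"
proof -
  have "of_set (A \<union> B) ^ 2 = of_set A ^ 2 + of_set B ^ 2 + 2 * (of_set UNIV - 1)"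
    by (simp add: of_set_union[OF disjoint] power2_sum product mult.assoc)
  then show ?thesis
    using sq_sum[of h] disjoint
    by (auto simp: lookup_add lookup_minus lookup_numeral_times lookup_of_set lookup_numeral when_def image_Un)
qed

section \<open>First and second moment of the coefficients of \<open>Q\<close>\<close>

definition Q :: "'a group_ring" where
  "Q = of_set (dbl (A \<union> B)) * of_set A"

lemma Q_nonneg: "coeff Q h \<ge> 0"
  by (simp add: Q_def lookup_of_set_times)

lemma sum_Q: "(\<Sum>h\<in>UNIV. coeff Q h) = (2 * int n + 1) * int (card A)"
proof -
  have "card (dbl (A \<union> B)) = 2 * n + 1"
    using card_sum disjoint by (simp add: card_image inj_on_def card_Un_disjoint)
  then show ?thesis by (simp add: Q_def sum_lookup_times sum_lookup_of_set)
qed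

lemma sq_dbl: "coeff (of_set (dbl D) ^ 2) (g + g) = coeff (of_set D ^ 2) g" for D :: "'a set"
proof -
  have "{x \<in> dbl D. g + g - x \<in> dbl D} = dbl {x \<in> D. g - x \<in> D}"
  proof -
    have "g + g - (x + x) \<in> dbl D \<longleftrightarrow> g - x \<in> D" for x
      using dbl_mem_iff[of "g - x" D] by (simp add: algebra_simps)
    then show ?thesis by auto
  qed
  then show ?thesis
    by (simp add: power2_eq_square lookup_of_set_times card_image inj_on_def)
qed

text \<open>By symmetry the sum is the coefficient of \<open>Q * Q\<close> at 0. Regrouping
  \<open>Q * Q\<close> as \<open>?D ^ 2 * of_set A ^ 2\<close> brings in \<open>?D ^ 2\<close>,
  whose coefficients are explicit.\<close>

lemma sum_Q_square:
  "(\<Sum>h\<in>UNIV. coeff Q h ^ 2) = 4 * int (card A) ^ 2 + (2 * int n - 2) * int (card A)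
    - (\<Sum>h\<in>dbl (dbl (A \<union> B)). coeff (of_set A ^ 2) h)"
proof -
  let ?D = "of_set (dbl (A \<union> B)) :: 'a group_ring"
  have neg: "- x \<in> dbl (A \<union> B) \<longleftrightarrow> x \<in> dbl (A \<union> B)" for x
  proof -
    obtain g where "x = g + g" using dblE .
    then have "- x = - g + - g" by simp
    with \<open>x = g + g\<close> show ?thesis by (simp only: dbl_mem_iff Un_iff uminus_mem_A uminus_mem_B)
  qed
  have sym: "coeff Q (- x) = coeff Q x" "coeff (of_set A ^ 2) (- x) = coeff (of_set A ^ 2) x" for x
    unfolding Q_def power2_eq_square
    by (rule lookup_times_uminus; simp add: lookup_of_set neg)+
  have "(\<Sum>h\<in>UNIV. coeff Q h ^ 2) = coeff (Q * Q) 0"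
    by (simp add: lookup_times_zero_symmetric sym power2_eq_square)
  also have "Q * Q = ?D ^ 2 * of_set A ^ 2"
    by (simp add: Q_def power2_eq_square ac_simps)
  also have "coeff \<dots> 0 = (\<Sum>h\<in>UNIV. coeff (?D ^ 2) h * coeff (of_set A ^ 2) h)"
    by (rule lookup_times_zero_symmetric) (rule sym)
  \<comment> \<open>Every element is a double, and at doubles \<open>sq_dbl\<close> and
    \<open>hat_sq\<close> evaluate the first factor.\<close>
  also have "\<dots> = (\<Sum>g\<in>UNIV. coeff (?D ^ 2) (g + g) * coeff (of_set A ^ 2) (g + g))"
    by (rule sum.reindex_bij_betw[OF bij_dbl, symmetric])
  also have "\<dots> = (\<Sum>g\<in>UNIV. 4 * coeff (of_set A ^ 2) (g + g)
      - of_bool (g \<in> dbl (A \<union> B)) * coeff (of_set A ^ 2) (g + g)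
      + (2 * int n - 2) * (if g = 0 then coeff (of_set A ^ 2) 0 else 0))"
    by (rule sum.cong) (auto simp: sq_dbl hat_sq algebra_simps)
  also have "\<dots> = 4 * (\<Sum>g\<in>UNIV. coeff (of_set A ^ 2) (g + g))
      - (\<Sum>g\<in>dbl (A \<union> B). coeff (of_set A ^ 2) (g + g)) + (2 * int n - 2) * int (card A)"
    unfolding sum.distrib sum_subtractf sum_distrib_left[symmetric]
    by (simp only: sum_of_bool_mult_eq finite sum.delta sq_zero Int_UNIV_left Collect_mem_eq
        UNIV_I if_True)
  also have "(\<Sum>g\<in>UNIV. coeff (of_set A ^ 2) (g + g)) = (\<Sum>h\<in>UNIV. coeff (of_set A ^ 2) h)"
    by (rule sum.reindex_bij_betw[OF bij_dbl])
  also have "\<dots> = int (card A) ^ 2"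
    by (simp add: power2_eq_square sum_lookup_times sum_lookup_of_set)
  also have "(\<Sum>g\<in>dbl (A \<union> B). coeff (of_set A ^ 2) (g + g))
      = (\<Sum>h\<in>dbl (dbl (A \<union> B)). coeff (of_set A ^ 2) h)"
    by (rule sum.reindex[unfolded o_def, symmetric]) (simp add: inj_on_def)
  finally show ?thesis by simp
qed

text \<open>By \<open>sq_cases\<close> a nonzero quadruple contributes 1 if it is a double of an
  element of \<open>A\<close>, and 2 if it lies elsewhere in the support. The former are counted by
  their halves.\<close>

lemma sum_sq_quadruples:
  assumes "0 \<in> A \<union> B"
  shows "(\<Sum>h\<in>dbl (dbl (A \<union> B)). coeff (of_set A ^ 2) h)
    = int (card A) + int (card (A \<inter> dbl (A \<union> B) - {0}))
      + 2 * int (card ((supp (of_set A ^ 2) - (dbl A \<union> {0})) \<inter> dbl (dbl (A \<union> B))))"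
    (is "sum ?f ?P = _ + int (card ?R) + 2 * int (card ?S)")
proof -
  have "0 \<in> ?P" using assms by auto
  then have "sum ?f ?P = int (card A) + sum ?f (?P - {0})"
    by (simp add: sum.remove[of ?P 0] sq_zero)
  also have "sum ?f (?P - {0}) = (\<Sum>h\<in>?P - {0}. of_bool (h \<in> dbl A)
      + 2 * of_bool (h \<in> supp (of_set A ^ 2) - dbl A))"
    by (rule sum.cong) (auto simp: sq_cases(1))
  also have "\<dots> = int (card {h \<in> ?P - {0}. h \<in> dbl A})
      + 2 * int (card {h \<in> ?P - {0}. h \<in> supp (of_set A ^ 2) - dbl A})"
    by (simp only: sum.distrib sum_distrib_left[symmetric] sum_of_bool_card finite)
  also have "{h \<in> ?P - {0}. h \<in> dbl A} = dbl ?R" by auto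
  also have "card (dbl ?R) = card ?R" by (simp add: card_image inj_on_def)
  also have "{h \<in> ?P - {0}. h \<in> supp (of_set A ^ 2) - dbl A} = ?S" by auto
  finally show ?thesis by simp
qed

section \<open>Triples of elements of \<open>A\<close>, and \<open>Q\<close> modulo 3\<close>

definition cubes :: "'a \<Rightarrow> int" where
  "cubes h = coeff (power_map (of_set A) 3) h"

lemma cubes_card: "cubes h = int (card {a \<in> A. a + a + a = h})"
  by (simp add: cubes_def lookup_power_map_of_set int_mult_simps)

lemma sum_cubes: "(\<Sum>h\<in>UNIV. cubes h) = int (card A)"
proof -
  have "(\<Sum>h\<in>UNIV. cubes h) = (\<Sum>g\<in>A. \<Sum>h\<in>UNIV. coeff (Poly_Mapping.single (int_mult 3 g) 1) h)"
    unfolding cubes_def power_map_of_set lookup_sum by (rule sum.swap)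
  then show ?thesis by (simp add: lookup_single when_def)
qed

text \<open>Solving \<open>squares\<close> for the set of doubles and multiplying by
  \<open>a\<close> leaves \<open>a ^ 3\<close>, which is \<open>cubes\<close> modulo 3, and
  \<open>b * (a * b)\<close>, which \<open>product\<close> evaluates.\<close>

lemma Q_mod_3: "coeff Q h mod 3 = (of_bool (h \<in> B) + 2 * of_bool (h \<in> A) - cubes h) mod 3"
  if ab: "card A = n \<and> card B = n + 1 \<or> card A = n + 1 \<and> card B = n"
proof -
  define U where "U = (of_set UNIV :: 'a group_ring)"
  define a where "a = (of_set A :: 'a group_ring)"
  define b where "b = (of_set B :: 'a group_ring)"
  have D: "of_set (dbl (A \<union> B)) = 2 * U - a ^ 2 - b ^ 2 + of_nat (2 * n)"
  proof -
    have "dbl A \<inter> dbl B = {}" using disjoint by auto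
    then have "of_set (dbl (A \<union> B)) = power_map (of_set A) 2 + power_map (of_set B) 2"
      by (simp add: image_Un of_set_union power_map_2)
    also have "\<dots> = 2 * U + of_nat (2 * n) - (a ^ 2 + b ^ 2)"
      unfolding U_def a_def b_def squares by simp
    finally show ?thesis by (simp add: algebra_simps)
  qed
  have "Q = 2 * (U * a) - a ^ 3 - b * (a * b) + of_nat (2 * n) * a"
    unfolding Q_def D a_def[symmetric] by (simp add: power2_eq_square power3_eq_cube algebra_simps)
  also have "b * (a * b) = U * b - b"
    by (simp add: a_def b_def U_def product algebra_simps)
  finally have "coeff Q h = 2 * int (card A) - coeff (of_set A ^ 3) h
      - (int (card B) - of_bool (h \<in> B)) + 2 * int n * of_bool (h \<in> A)"
    unfolding U_def a_def b_def
    by (simp only: lookup_add lookup_minus lookup_numeral_times lookup_of_nat_times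
        lookup_UNIV_times sum_lookup_of_set lookup_of_set) simp
  moreover obtain m where "int n = 3 * m + 1"
  proof -
    have "int n = 3 * (int n div 3) + 1" using n_mod_6 by presburger
    then show ?thesis using that by blast
  qed
  moreover obtain k where "coeff (of_set A ^ 3) h = cubes h + 3 * k"
  proof -
    have "3 dvd coeff (of_set A ^ 3) h - cubes h"
      using lookup_cube_mod_3[of A h] by (simp only: cubes_def mod_eq_dvd_iff)
    then obtain k where "coeff (of_set A ^ 3) h - cubes h = 3 * k" by (rule dvdE)
    then show ?thesis using that[of k] by simp
  qed
  \<comment> \<open>The constant \<open>2 * card A - card B\<close> is \<open>n - 1 = 3 * m\<close>
    or \<open>n + 2 = 3 * m + 3\<close>; the last indicator on the right records the
    difference.\<close>
  ultimately have "coeff Q h - (of_bool (h \<in> B) + 2 * of_bool (h \<in> A) - cubes h)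
      = 3 * (m - k + 2 * m * of_bool (h \<in> A) + of_bool (card A = n + 1))"
    using ab by (elim disjE conjE) (simp_all only: of_nat_add of_nat_1 of_bool_eq, simp_all add: algebra_simps)
  then show ?thesis by (simp add: mod_eq_dvd_iff)
qed

text \<open>Three solutions would fill a coset of a subgroup of order 3, where each point is the
  midpoint of the other two. By \<open>sq_dbl_unique\<close> two distinct points would then both be
  0.\<close>

lemma cubes_le_2: "cubes h \<le> 2"
proof (rule ccontr)
  assume "\<not> cubes h \<le> 2"
  then have "3 \<le> card {a \<in> A. a + a + a = h}" by (simp add: cubes_card)
  then obtain S where "S \<subseteq> {a \<in> A. a + a + a = h}" "card S = 3"
    by (rule obtain_subset_with_card_n)
  moreover from this(2) obtain x y z where "S = {x, y, z}" and ne: "x \<noteq> y" "y \<noteq> z" "x \<noteq> z"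
    unfolding card_3_iff by blast
  ultimately have xyz: "x \<in> A" "y \<in> A" "z \<in> A" "x + x + x = h" "y + y + y = h" "z + z + z = h"
    by auto
  \<comment> \<open>The points of a coset of a group of order 3 form an arithmetic progression in any order.\<close>
  have line: "z + x = y + y" if "x \<noteq> y" "y \<noteq> z" "x \<noteq> z" "x + x + x = y + y + y" "x + x + x = z + z + z"
    for x y z :: 'a
  proof -
    have *: "(u - v) + (u - v) + (u - v) = (u + u + u) - (v + v + v)" for u v :: 'a
      by simp
    have "z - x \<in> {0, y - x, (y - x) + (y - x)}"
      by (rule three_torsion[OF not_9_dvd_card_UNIV]; (unfold *)?) (use that in simp_all)
    moreover have "z - x \<noteq> 0" "z - x \<noteq> y - x" using that by simp_all
    ultimately have "z - x = (y - x) + (y - x)" by blast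
    then show ?thesis by (simp add: algebra_simps)
  qed
  have "z + x = y + y" "z + y = x + x"
    using line[of x y z] line[of y x z] xyz ne by simp_all
  then have "y = 0" "x = 0"
    using sq_dbl_unique[of z x y] sq_dbl_unique[of z y x] xyz ne by blast+
  then show False using ne by simp
qed

lemma cubes_nonneg: "cubes h \<ge> 0"
  by (simp add: cubes_card)

end

section \<open>Pointwise inequalities for a nonnegative integer and its residue modulo 3\<close>

text \<open>These are applied to each coefficient \<open>c\<close> and summed over the group. The
  first is an equality exactly for \<open>c \<le> 3\<close>, which is why vanishing of its sum
  bounds all coefficients.\<close>

lemma defect_inequalities:
  fixes c :: int
  assumes "c \<ge> 0"
  defines "r \<equiv> of_bool (c mod 3 \<noteq> 0)" and "m \<equiv> c mod 3"
  shows "0 \<le> c ^ 2 - 3 * c + 2 * r"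
    and "c ^ 2 - 3 * c + 2 * r \<le> 0 \<Longrightarrow> c \<le> 3"
    and "0 \<le> c - m - 3 * of_bool (c = 3)"
    and "0 \<le> c ^ 2 - 3 * c + 2 * r - 2 * (c - m - 3 * of_bool (c = 3))"
    and "0 \<le> 1 - r - of_bool (c = 3) - of_bool (c = 0)"
    and "0 \<le> 3 * of_bool (c = 0) - 3 * (1 - r) + (c - m)"
proof -
  \<comment> \<open>For \<open>c \<ge> 5\<close> the hardest claim, the fourth, becomes
    \<open>c ^ 2 - 5 * c + 2 * r + 2 * m \<ge> 0\<close>, which explains the threshold 5.\<close>
  consider "c = 0" | "c = 1" | "c = 2" | "c = 3" | "c = 4" | "c \<ge> 5"
    using assms(1) by linarith
  then have "0 \<le> c ^ 2 - 3 * c + 2 * r \<and> (c ^ 2 - 3 * c + 2 * r \<le> 0 \<longrightarrow> c \<le> 3) \<and>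
    0 \<le> c - m - 3 * of_bool (c = 3) \<and>
    0 \<le> c ^ 2 - 3 * c + 2 * r - 2 * (c - m - 3 * of_bool (c = 3)) \<and>
    0 \<le> 1 - r - of_bool (c = 3) - of_bool (c = 0) \<and>
    0 \<le> 3 * of_bool (c = 0) - 3 * (1 - r) + (c - m)"
  proof cases
    case 6
    have "0 \<le> m" "m \<le> 2" "0 \<le> r" "r \<le> 1" by (auto simp: m_def r_def)
    moreover have "5 * c \<le> c ^ 2"
      using mult_right_mono[OF 6, of c] 6 by (simp add: power2_eq_square)
    moreover have "c \<noteq> 3" "c \<noteq> 0" using 6 by auto
    ultimately show ?thesis using 6 by simp
  qed (simp_all add: r_def m_def)
  then show "0 \<le> c ^ 2 - 3 * c + 2 * r" "c ^ 2 - 3 * c + 2 * r \<le> 0 \<Longrightarrow> c \<le> 3"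
    "0 \<le> c - m - 3 * of_bool (c = 3)"
    "0 \<le> c ^ 2 - 3 * c + 2 * r - 2 * (c - m - 3 * of_bool (c = 3))"
    "0 \<le> 1 - r - of_bool (c = 3) - of_bool (c = 0)"
    "0 \<le> 3 * of_bool (c = 0) - 3 * (1 - r) + (c - m)"
    by blast+
qed

section \<open>The coefficients for \<open>T0\<close> and the sets \<open>X_set\<close>\<close>

lemma card_eq_sum_of_bool: "int (card S) = (\<Sum>h\<in>UNIV. of_bool (h \<in> (S :: 'a::finite set)))"
  by (simp add: sum_of_bool_card)

locale based_lee_pair = lee_pair n T0 T1 for n :: nat and T0 T1 :: "'a::{ab_group_add,finite} set" +
  assumes zero_mem: "0 \<in> T0"
begin

text \<open>Facts with the prefix \<open>swapped\<close> are those about \<open>T1\<close>; in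
  particular \<open>swapped.Q\<close> has the coefficients that define \<open>Y_set\<close>.\<close>

sublocale swapped: lee_pair n T1 T0
  by (rule swap)

lemma zero_not_mem: "0 \<notin> T1"
  using zero_mem disjoint by auto

lemma card_T0: "card T0 = n" and card_T1: "card T1 = n + 1"
proof -
  \<comment> \<open>The coefficient of the square of \<open>T0\<close> at 0 is
    \<open>card T0\<close>, and it is odd because 0 is the double of an element of
    \<open>T0\<close>.\<close>
  have "int (card T0) mod 2 = 1"
    using sq_parity[of 0] by (simp add: sq_zero zero_mem)
  moreover have "(int (card T0) - int n) * (int (card T0) - (int n + 1)) = 0"
  proof -
    have *: "int (card T1) = 2 * int n + 1 - int (card T0)" using card_sum by linarith
    have "int (card T0) * int (card T1) = int n ^ 2 + int n"
      using card_mult by (metis of_nat_add of_nat_mult of_nat_power)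
    then show ?thesis unfolding * by (simp add: power2_eq_square algebra_simps)
  qed
  then have "int (card T0) = int n \<or> int (card T0) = int n + 1" by simp
  ultimately show "card T0 = n" using odd_n by presburger
  then show "card T1 = n + 1" using card_sum by simp
qed

lemma T_hat_eq: "T_hat T0 T1 = of_set (T0 \<union> T1)"
  by (simp add: T_hat_def of_set_union disjoint)

lemma Q_eq: "power_map (T_hat T0 T1) 2 * of_set T0 = Q"
  "power_map (T_hat T0 T1) 2 * of_set T1 = swapped.Q"
  by (simp_all only: T_hat_eq power_map_2 Q_def swapped.Q_def Un_commute[of T1])

text \<open>A nonzero \<open>h\<close> in \<open>T0\<close> has the two representations
  \<open>0 + h\<close> and \<open>h + 0\<close>, whereas nonzero doubles have coefficient at most 1
  in the square of \<open>T0\<close>.\<close>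

lemma T0_inter_dbl: "T0 \<inter> dbl (T0 \<union> T1) = {0}"
proof -
  have "h = 0" if "h \<in> T0" "h \<in> dbl (T0 \<union> T1)" for h
  proof (rule ccontr)
    assume "h \<noteq> 0"
    have "{0, h} \<subseteq> {x \<in> T0. h - x \<in> T0}" using that zero_mem by auto
    from card_mono[OF _ this] \<open>h \<noteq> 0\<close> have "coeff (of_set T0 ^ 2) h \<ge> 2"
      by (simp add: power2_eq_square lookup_of_set_times)
    moreover have "h \<in> dbl T0 \<or> h \<in> dbl T1" using that by auto
    ultimately show False using sq_cases[OF \<open>h \<noteq> 0\<close>] by auto
  qed
  moreover have "0 \<in> dbl (T0 \<union> T1)" using zero_mem by simp
  ultimately show ?thesis using zero_mem by auto
qed

text \<open>From \<open>a + a + a = h\<close> follows \<open>h + (- a) = a + a\<close>, so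
  \<open>a\<close> is the midpoint of two elements of \<open>T0\<close>. If \<open>a\<close> were
  nonzero, this would force \<open>h = a\<close> and hence \<open>a + a = 0\<close>.\<close>

lemma cubes_on_T0:
  assumes "h \<in> T0"
  shows "cubes h = of_bool (h = 0)"
proof -
  have *: "a = 0" if "a \<in> T0" "a + a + a = h" for a
  proof (rule ccontr)
    assume "a \<noteq> 0"
    have "h + - a = a + a" using that(2) by (simp add: algebra_simps)
    then have "h = a" using sq_dbl_unique[of h "- a" a] that(1) \<open>a \<noteq> 0\<close> assms by simp
    then have "a + a = 0" using that(2) by (simp add: add.assoc)
    then show False using \<open>a \<noteq> 0\<close> by simp
  qed
  have "{a \<in> T0. a + a + a = h} = (if h = 0 then {0} else {})"
    using * zero_mem by force
  then show ?thesis by (simp add: cubes_card)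
qed

lemma sum_Q_square_T0:
  "(\<Sum>h\<in>UNIV. coeff Q h ^ 2) = 6 * int n ^ 2 - 3 * int n - 2 * int (theta0 T0 T1)"
proof -
  have "supp (of_set T0 ^ 2) - (dbl T0 \<union> {0}) = supp (of_set T0 ^ 2) - dbl T0"
    using zero_mem by force
  then have "int (theta0 T0 T1)
      = int (card ((supp (of_set T0 ^ 2) - (dbl T0 \<union> {0})) \<inter> dbl (dbl (T0 \<union> T1))))"
    by (simp only: theta0_def T_hat_eq power_map_2 power_map_4 supp_of_set)
  then show ?thesis
    using sum_Q_square sum_sq_quadruples zero_mem
    by (simp add: T0_inter_dbl card_T0 power2_eq_square algebra_simps)
qed

text \<open>Puts the cases of \<open>Q_mod_3\<close> into a linear form in functions with known
  sums, up to two correction terms. These mark the positions of triples that are excluded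
  next.\<close>

lemma residue_T0:
  "of_bool (coeff Q h mod 3 \<noteq> 0) = of_bool (h \<in> T0) + of_bool (h \<in> T1) + cubes h - of_bool (h = 0)
    - 2 * of_bool (h \<in> T1 \<and> cubes h \<ge> 1) - of_bool (h \<notin> T0 \<union> T1 \<and> cubes h = (2::int))"
proof -
  have c: "cubes h = 0 \<or> cubes h = 1 \<or> cubes h = 2"
    using cubes_nonneg[of h] cubes_le_2[of h] by linarith
  have q: "coeff Q h mod 3 = (of_bool (h \<in> T1) + 2 * of_bool (h \<in> T0) - cubes h) mod 3"
    by (rule Q_mod_3) (simp add: card_T0 card_T1)
  consider "h \<in> T0" "h \<notin> T1" | "h \<notin> T0" "h \<in> T1" "h \<noteq> 0" | "h \<notin> T0" "h \<notin> T1" "h \<noteq> 0"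
    using disjoint zero_mem zero_not_mem by blast
  then show ?thesis
  proof cases
    case 1 then show ?thesis using cubes_on_T0[of h] by (simp add: q)
  qed (use c in \<open>elim disjE; simp add: q\<close>)+
qed

text \<open>A nonnegative function \<open>F\<close> has sum \<open>-2 * theta0 T0 T1\<close>. Hence
  both \<open>theta0\<close> and every nonnegative summand of \<open>F\<close> vanish, which yields
  all four claims at once.\<close>

lemma theta0_eq_0: "theta0 T0 T1 = 0"
  and Q_le_3: "coeff Q h \<le> 3"
  and cubes_on_T1: "h \<in> T1 \<Longrightarrow> cubes h = 0"
  and cubes_off: "h \<notin> T0 \<union> T1 \<Longrightarrow> cubes h \<noteq> 2"
proof -
  \<comment> \<open>The weights 4 and 2 are twice those of the corrections in
    \<open>residue_T0\<close>, so that the corrections cancel in the sum.\<close>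
  define F where "F h = (coeff Q h ^ 2 - 3 * coeff Q h + 2 * of_bool (coeff Q h mod 3 \<noteq> 0))
    + 4 * of_bool (h \<in> T1 \<and> cubes h \<ge> 1) + 2 * of_bool (h \<notin> T0 \<union> T1 \<and> cubes h = 2)" for h
  have nonneg: "F h \<ge> 0" for h
    using defect_inequalities(1)[OF Q_nonneg[of h]] by (simp add: F_def)
  have "F h = coeff Q h ^ 2 - 3 * coeff Q h + 2 * of_bool (h \<in> T0) + 2 * of_bool (h \<in> T1)
      + 2 * cubes h - 2 * of_bool (h \<in> {0})" for h
    unfolding F_def residue_T0 by simp
  then have "sum F UNIV = (\<Sum>h\<in>UNIV. coeff Q h ^ 2 - 3 * coeff Q h + 2 * of_bool (h \<in> T0)
      + 2 * of_bool (h \<in> T1) + 2 * cubes h - 2 * of_bool (h \<in> {0}))"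
    by (rule sum.cong[OF refl])
  then have sum_F: "sum F UNIV = -2 * int (theta0 T0 T1)"
    unfolding sum.distrib sum_subtractf sum_distrib_left[symmetric] sum_Q_square_T0 sum_Q
        sum_cubes card_eq_sum_of_bool[symmetric] card_T0 card_T1
    by (simp add: power2_eq_square algebra_simps)
  moreover have "sum F UNIV \<ge> 0" by (simp add: sum_nonneg nonneg)
  ultimately show "theta0 T0 T1 = 0" by linarith
  with sum_F have "sum F UNIV = 0" by simp
  then have F0: "F h = 0" for h
    using sum_nonneg_eq_0_iff[of UNIV F] nonneg by simp
  have "0 \<le> (of_bool (h \<in> T1 \<and> cubes h \<ge> 1) :: int)"
    "0 \<le> (of_bool (h \<notin> T0 \<union> T1 \<and> cubes h = 2) :: int)" by simp_all
  then have z: "coeff Q h ^ 2 - 3 * coeff Q h + 2 * of_bool (coeff Q h mod 3 \<noteq> 0) \<le> 0"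
    "of_bool (h \<in> T1 \<and> cubes h \<ge> 1) = (0 :: int)"
    "of_bool (h \<notin> T0 \<union> T1 \<and> cubes h = 2) = (0 :: int)"
    using defect_inequalities(1)[OF Q_nonneg[of h]] F0[of h, unfolded F_def] by linarith+
  show "coeff Q h \<le> 3"
    by (rule defect_inequalities(2)[OF Q_nonneg z(1)])
  show "cubes h = 0" if "h \<in> T1"
    using z(2) that cubes_nonneg[of h] by simp
  show "cubes h \<noteq> 2" if "h \<notin> T0 \<union> T1"
    using z(3) that by simp
qed

text \<open>Coefficients are now at most 3, so the residue modulo 3 recognizes the values 1 and 2;
  it cannot separate 0 from 3.\<close>

lemma Q_values:
  "of_bool (coeff Q h = 1) = of_bool (h \<in> T1) + (of_bool (h \<in> {0}) :: int)"
  "of_bool (coeff Q h = 2) = of_bool (h \<in> T0) + cubes h - 2 * (of_bool (h \<in> {0}) :: int)"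
proof -
  have c: "cubes h = 0 \<or> cubes h = 1 \<or> cubes h = 2"
    using cubes_nonneg[of h] cubes_le_2[of h] by linarith
  have v: "coeff Q h = 0 \<or> coeff Q h = 1 \<or> coeff Q h = 2 \<or> coeff Q h = 3"
    using Q_nonneg[of h] Q_le_3[of h] by linarith
  have q: "coeff Q h mod 3 = (of_bool (h \<in> T1) + 2 * of_bool (h \<in> T0) - cubes h) mod 3"
    by (rule Q_mod_3) (simp add: card_T0 card_T1)
  have v1: "coeff Q h = 1 \<longleftrightarrow> coeff Q h mod 3 = 1" and v2: "coeff Q h = 2 \<longleftrightarrow> coeff Q h mod 3 = 2"
    using v by (elim disjE; simp)+
  consider "h \<in> T0" "h \<notin> T1" | "h \<notin> T0" "h \<in> T1" "h \<noteq> 0" | "h \<notin> T0" "h \<notin> T1" "h \<noteq> 0"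
    using disjoint zero_mem zero_not_mem by blast
  then have "of_bool (coeff Q h = 1) = of_bool (h \<in> T1) + (of_bool (h \<in> {0}) :: int) \<and>
    of_bool (coeff Q h = 2) = of_bool (h \<in> T0) + cubes h - 2 * (of_bool (h \<in> {0}) :: int)"
  proof cases
    case 1 then show ?thesis by (simp add: v1 v2 q cubes_on_T0)
  next
    case 2 then show ?thesis by (simp add: v1 v2 q cubes_on_T1)
  next
    case 3
    then have "cubes h = 0 \<or> cubes h = 1" using c cubes_off by blast
    with 3 show ?thesis by (elim disjE) (simp_all add: v1 v2 q)
  qed
  then show "of_bool (coeff Q h = 1) = of_bool (h \<in> T1) + (of_bool (h \<in> {0}) :: int)"
    "of_bool (coeff Q h = 2) = of_bool (h \<in> T0) + cubes h - 2 * (of_bool (h \<in> {0}) :: int)"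
    by blast+
qed

lemma card_X_set: "int (card (X_set T0 T1 i)) = (\<Sum>h\<in>UNIV. of_bool (coeff Q h = int i))"
  unfolding card_eq_sum_of_bool by (simp only: X_set_def coeff_set_def Q_eq mem_Collect_eq)

lemma card_Y_set: "int (card (Y_set T0 T1 i)) = (\<Sum>h\<in>UNIV. of_bool (coeff swapped.Q h = int i))"
  unfolding card_eq_sum_of_bool by (simp only: Y_set_def coeff_set_def Q_eq mem_Collect_eq)

text \<open>The counts for 1 and 2 come from \<open>Q_values\<close>. The total of all coefficients
  then gives the count for 3, and the order of the group the count for 0.\<close>

lemma X_cards:
  "int (card (X_set T0 T1 1)) = int n + 2"
  "int (card (X_set T0 T1 2)) = 2 * int n - 2"
  "3 * int (card (X_set T0 T1 3)) = 2 * (int n - 1) ^ 2"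
  "3 * int (card (X_set T0 T1 0)) = (int n - 1) ^ 2"
  "i > 3 \<Longrightarrow> X_set T0 T1 i = {}"
proof -
  show x1: "int (card (X_set T0 T1 1)) = int n + 2"
    unfolding card_X_set of_nat_1 Q_values sum.distrib card_eq_sum_of_bool[symmetric]
    by (simp add: card_T1)
  show x2: "int (card (X_set T0 T1 2)) = 2 * int n - 2"
    unfolding card_X_set of_nat_numeral Q_values sum.distrib sum_subtractf sum_distrib_left[symmetric]
      card_eq_sum_of_bool[symmetric] sum_cubes
    by (simp add: card_T0)
  have sq: "(int n - 1) ^ 2 = int n * int n - 2 * int n + 1"
    by (simp add: power2_eq_square algebra_simps)
  have v: "coeff Q h = 0 \<or> coeff Q h = 1 \<or> coeff Q h = 2 \<or> coeff Q h = 3" for h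
    using Q_nonneg[of h] Q_le_3[of h] by linarith
  have "coeff Q h = of_bool (coeff Q h = int 1) + 2 * of_bool (coeff Q h = int 2)
      + 3 * of_bool (coeff Q h = int 3)" for h
    using v[of h] by (elim disjE) simp_all
  then have "(\<Sum>h\<in>UNIV. coeff Q h) = (\<Sum>h\<in>UNIV. of_bool (coeff Q h = int 1)
      + 2 * of_bool (coeff Q h = int 2) + 3 * of_bool (coeff Q h = int 3))"
    by (rule sum.cong[OF refl])
  then have s: "(\<Sum>h\<in>UNIV. coeff Q h) = int (card (X_set T0 T1 1))
      + 2 * int (card (X_set T0 T1 2)) + 3 * int (card (X_set T0 T1 3))"
    unfolding sum.distrib sum_distrib_left[symmetric] card_X_set[symmetric] .
  then show x3: "3 * int (card (X_set T0 T1 3)) = 2 * (int n - 1) ^ 2"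
    unfolding x1 x2 sum_Q card_T0 sq by (simp add: algebra_simps)
  have "1 = of_bool (coeff Q h = int 0) + of_bool (coeff Q h = int 1) + of_bool (coeff Q h = int 2)
      + (of_bool (coeff Q h = int 3) :: int)" for h
    using v[of h] by (elim disjE) simp_all
  then have "(\<Sum>h\<in>(UNIV :: 'a set). 1) = (\<Sum>h\<in>UNIV. of_bool (coeff Q h = int 0)
      + of_bool (coeff Q h = int 1) + of_bool (coeff Q h = int 2) + (of_bool (coeff Q h = int 3) :: int))"
    by (rule sum.cong[OF refl])
  then have "int (card (UNIV :: 'a set)) = int (card (X_set T0 T1 0)) + int (card (X_set T0 T1 1))
      + int (card (X_set T0 T1 2)) + int (card (X_set T0 T1 3))"
    unfolding sum.distrib card_X_set[symmetric] by simp
  then show "3 * int (card (X_set T0 T1 0)) = (int n - 1) ^ 2"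
    using x3 unfolding x1 x2 card_UNIV sq by (simp add: power2_eq_square)
  show "X_set T0 T1 i = {}" if "i > 3"
  proof -
    have "coeff Q h \<noteq> int i" for h using Q_le_3[of h] that by linarith
    then show ?thesis by (simp add: X_set_def coeff_set_def Q_eq)
  qed
qed

lemma T0_cubes_location: "T1 \<inter> supp (power_map (of_set T0) 3) = {}" "Delta T0 \<subseteq> T1"
proof -
  show "T1 \<inter> supp (power_map (of_set T0) 3) = {}"
    using cubes_on_T1 by (auto simp: supp_def cubes_def)
  \<comment> \<open>So \<open>Delta T0\<close> is in fact empty.\<close>
  have "cubes h \<noteq> 2" for h
    using cubes_on_T0[of h] cubes_on_T1[of h] cubes_off[of h] by (cases "h \<in> T0"; cases "h \<in> T1") auto
  then show "Delta T0 \<subseteq> T1"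
    by (simp add: Delta_def coeff_set_def cubes_def[symmetric])
qed

section \<open>The coefficients for \<open>T1\<close> and the bounds for
  \<open>Y_set\<close>\<close>

text \<open>\<open>theta1\<close> may be a half-integer, so its double \<open>t\<close> is used to
  stay within the integers.\<close>

lemma sum_Q_square_T1:
  "(\<Sum>h\<in>UNIV. coeff swapped.Q h ^ 2) = 6 * int n ^ 2 + 7 * int n + 1 - t"
  if "2 * theta1 T0 T1 = of_int t"
proof -
  let ?t = "int (card (T1 \<inter> dbl (T1 \<union> T0) - {0}))
    + 2 * int (card ((supp (of_set T1 ^ 2) - (dbl T1 \<union> {0})) \<inter> dbl (dbl (T1 \<union> T0))))"
  have "T1 \<inter> dbl (T1 \<union> T0) - {0} = T1 \<inter> dbl (T1 \<union> T0)"
    using zero_not_mem by blast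
  then have "2 * theta1 T0 T1 = of_int ?t"
    unfolding theta1_def T_hat_eq power_map_2 power_map_4 supp_of_set Un_commute[of T0 T1] by simp
  with that have "(of_int t :: real) = of_int ?t" by (simp only:)
  then have "t = ?t" by (simp only: of_int_eq_iff)
  then show ?thesis
    using swapped.sum_Q_square swapped.sum_sq_quadruples zero_mem
    by (simp add: card_T1 power2_eq_square algebra_simps)
qed

text \<open>Linear forms of the cases of \<open>Q_mod_3\<close>, arranged so that the indicators sum
  to the four cardinalities \<open>u0\<close>, \<open>u1\<close>, \<open>d1\<close> and
  \<open>d2\<close> of \<open>Y_bounds\<close>.\<close>

lemma residue_T1:
  defines "s \<equiv> swapped.cubes"
  shows "of_bool (coeff swapped.Q h mod 3 \<noteq> 0) = of_bool (h \<in> T0) + of_bool (h \<in> T1) + s h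
      - (2 * of_bool (s h > 0 \<and> h \<in> T0) + of_bool (s h > 0 \<and> h \<in> T1)
        + 2 * of_bool (s h = 2 \<and> h \<in> T1) + (of_bool (s h = 2 \<and> h \<notin> T0 \<union> T1) :: int))"
    (is ?R)
  and "coeff swapped.Q h mod 3 = of_bool (h \<in> T0) + 2 * of_bool (h \<in> T1) + 2 * s h
      - 3 * (of_bool (s h > 0 \<and> h \<in> T0) + of_bool (s h > 0 \<and> h \<in> T1)
        + of_bool (s h = 2 \<and> h \<in> T1) + of_bool (s h = 2 \<and> h \<notin> T0 \<union> T1))" (is ?M)
proof -
  have c: "s h = 0 \<or> s h = 1 \<or> s h = 2"
    using swapped.cubes_nonneg[of h] swapped.cubes_le_2[of h] unfolding s_def by linarith
  have q: "coeff swapped.Q h mod 3 = (of_bool (h \<in> T0) + 2 * of_bool (h \<in> T1) - s h) mod 3"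
    unfolding s_def by (rule swapped.Q_mod_3) (simp add: card_T0 card_T1)
  consider "h \<in> T0" "h \<notin> T1" | "h \<notin> T0" "h \<in> T1" | "h \<notin> T0" "h \<notin> T1"
    using disjoint by blast
  then have "?R \<and> ?M"
    unfolding q using c by cases (elim disjE; simp)+
  then show ?R ?M by blast+
qed

lemma Y_bounds:
  fixes t :: int
  assumes t: "2 * theta1 T0 T1 = of_int t"
  defines "u0 \<equiv> int (card (supp (power_map (of_set T1) 3) \<inter> T0))"
    and "u1 \<equiv> int (card (supp (power_map (of_set T1) 3) \<inter> T1))"
    and "d1 \<equiv> int (card (Delta T1 \<inter> T1))"
    and "d2 \<equiv> int (card (Delta T1 - (T0 \<union> T1)))"
    and "y0 \<equiv> int (card (Y_set T0 T1 0))"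
    and "y3 \<equiv> int (card (Y_set T0 T1 3))"
  shows "2 * (2 * int n ^ 2 - 5 * int n - 4) + t + 6 * (2 * u0 + u1 + 2 * d1 + d2) \<le> 6 * y3"
    and "3 * y3 \<le> 2 * int n ^ 2 - 2 * int n - 3 + 3 * (u0 + u1 + d1 + d2)"
    and "2 * (int n ^ 2 - 10 * int n - 3) - 6 * (u0 + u1 + d1 + d2) + 3 * t \<le> 6 * y0"
    and "6 * y0 \<le> 2 * (int n ^ 2 - int n + 1) - t"
proof -
  define s where "s = swapped.cubes"
  define c where "c = coeff swapped.Q"
  define r :: "'a \<Rightarrow> int" where "r h = of_bool (c h mod 3 \<noteq> 0)" for h
  define m where "m h = c h mod 3" for h
  define e3 :: "'a \<Rightarrow> int" where "e3 h = of_bool (c h = 3)" for h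
  define e0 :: "'a \<Rightarrow> int" where "e0 h = of_bool (c h = 0)" for h
  have cubes: "supp (power_map (of_set T1) 3) = {h. s h > 0}" "Delta T1 = {h. s h = 2}"
    by (simp_all add: supp_def Delta_def coeff_set_def s_def swapped.cubes_def)
  have counts: "u0 = (\<Sum>h\<in>UNIV. of_bool (s h > 0 \<and> h \<in> T0))"
    "u1 = (\<Sum>h\<in>UNIV. of_bool (s h > 0 \<and> h \<in> T1))"
    "d1 = (\<Sum>h\<in>UNIV. of_bool (s h = 2 \<and> h \<in> T1))"
    "d2 = (\<Sum>h\<in>UNIV. of_bool (s h = 2 \<and> h \<notin> T0 \<union> T1))"
    unfolding u0_def u1_def d1_def d2_def cubes card_eq_sum_of_bool by simp_all
  have T: "(\<Sum>h\<in>UNIV. of_bool (h \<in> T0)) = int n" "(\<Sum>h\<in>UNIV. of_bool (h \<in> T1)) = int n + 1"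
    unfolding card_eq_sum_of_bool[symmetric] by (simp_all add: card_T0 card_T1)
  have s: "sum s UNIV = int n + 1"
    by (simp add: s_def swapped.sum_cubes card_T1)
  have r: "sum r UNIV = 3 * int n + 2 - (2 * u0 + u1 + 2 * d1 + d2)"
    unfolding r_def c_def residue_T1(1) s_def[symmetric] sum.distrib sum_subtractf
      sum_distrib_left[symmetric] T s counts by simp
  have m: "sum m UNIV = 5 * int n + 4 - 3 * (u0 + u1 + d1 + d2)"
    unfolding m_def c_def residue_T1(2) s_def[symmetric] sum.distrib sum_subtractf
      sum_distrib_left[symmetric] T s counts by simp
  have c: "sum c UNIV = 2 * int n ^ 2 + 3 * int n + 1"
    unfolding c_def swapped.sum_Q card_T1 by (simp add: power2_eq_square algebra_simps)
  have c2: "(\<Sum>h\<in>UNIV. c h ^ 2) = 6 * int n ^ 2 + 7 * int n + 1 - t"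
    unfolding c_def by (rule sum_Q_square_T1[OF t])
  have y: "sum e3 UNIV = y3" "sum e0 UNIV = y0"
    unfolding y3_def y0_def card_Y_set e3_def e0_def c_def by simp_all
  have N: "(\<Sum>h\<in>(UNIV :: 'a set). 1) = int n ^ 2 + int n + 1"
    by (simp add: card_UNIV)
  note lin = sum.distrib sum_subtractf sum_distrib_left[symmetric] r m c c2 y N
  have nn: "c h \<ge> 0" for h by (simp add: c_def swapped.Q_nonneg)
  note ineq = defect_inequalities[OF nn, folded r_def m_def e3_def e0_def]
  \<comment> \<open>Sum \<open>2\<close> is the upper bound for \<open>y3\<close>, and
    \<open>3\<close> leads to the lower one. Combining the latter with \<open>4\<close> bounds
    \<open>y0\<close> from above; \<open>5\<close> bounds it from below, where \<open>1\<close>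
    serves to bring in \<open>t\<close>.\<close>
  have 1: "0 \<le> (\<Sum>h\<in>UNIV. c h ^ 2 - 3 * c h + 2 * r h)"
    by (intro sum_nonneg ineq(1))
  have 2: "0 \<le> (\<Sum>h\<in>UNIV. c h - m h - 3 * e3 h)"
    by (intro sum_nonneg ineq(3))
  have 3: "0 \<le> (\<Sum>h\<in>UNIV. c h ^ 2 - 3 * c h + 2 * r h - 2 * (c h - m h - 3 * e3 h))"
    by (intro sum_nonneg ineq(4))
  have 4: "0 \<le> (\<Sum>h\<in>UNIV. 1 - r h - e3 h - e0 h)"
    by (intro sum_nonneg ineq(5))
  have 5: "0 \<le> (\<Sum>h\<in>UNIV. 3 * e0 h - 3 * (1 - r h) + (c h - m h))"
    by (intro sum_nonneg ineq(6))
  \<comment> \<open>Beyond \<open>3\<close>, the lower bound for \<open>6 * y3\<close> requires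
    \<open>2 * (n - u0) + 2 * (u1 - d1) + 2 * d2 \<ge> 0\<close>.\<close>
  have "u0 \<le> int n"
    unfolding u0_def card_T0[symmetric] by (intro of_nat_mono card_mono) auto
  moreover have "d1 \<le> u1"
    unfolding u1_def d1_def cubes by (intro of_nat_mono card_mono) auto
  moreover have "0 \<le> u0" "0 \<le> u1" "0 \<le> d1" "0 \<le> d2"
    by (simp_all add: u0_def u1_def d1_def d2_def)
  ultimately show
    "2 * (2 * int n ^ 2 - 5 * int n - 4) + t + 6 * (2 * u0 + u1 + 2 * d1 + d2) \<le> 6 * y3"
    "3 * y3 \<le> 2 * int n ^ 2 - 2 * int n - 3 + 3 * (u0 + u1 + d1 + d2)"
    "2 * (int n ^ 2 - 10 * int n - 3) - 6 * (u0 + u1 + d1 + d2) + 3 * t \<le> 6 * y0"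
    "6 * y0 \<le> 2 * (int n ^ 2 - int n + 1) - t"
    using 1[unfolded lin] 2[unfolded lin] 3[unfolded lin] 4[unfolded lin] 5[unfolded lin]
    unfolding ring_distribs by linarith+
qed

end

theorem theorem4p2:
  fixes n :: nat and T0 T1 :: "'a::{ab_group_add,finite} set"
  assumes "n > 0" and "n mod 6 = 1"
    and "card (UNIV :: 'a set) = n ^ 2 + n + 1"
    and "inverse_closed T0" and "inverse_closed T1"
    and "0 \<in> T0"
    and "card T0 + card T1 = 2 * n + 1"
    and "of_set T0 * of_set T1 = of_set UNIV - 1"
    and "of_set T0 ^ 2 + of_set T1 ^ 2 =
           2 * of_set UNIV - power_map (of_set T0) 2 - power_map (of_set T1) 2
           + of_nat (2 * n) * 1"
  shows
    "(real (card (X_set T0 T1 0)) = 1 / 3 * (real n - 1) ^ 2 \<and>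
      real (card (X_set T0 T1 1)) = real n + 2 \<and>
      real (card (X_set T0 T1 2)) = 2 * real n - 2 \<and>
      real (card (X_set T0 T1 3)) = 2 / 3 * (real n - 1) ^ 2 \<and>
      (\<forall>i>3. card (X_set T0 T1 i) = 0)) \<and>
     (T1 \<inter> supp (power_map (of_set T0) 3) = {} \<and>
      theta0 T0 T1 = 0 \<and>
      Delta T0 \<subseteq> T1) \<and>
     (let u0 = real (card (supp (power_map (of_set T1) 3) \<inter> T0));
          u1 = real (card (supp (power_map (of_set T1) 3) \<inter> T1));
          d1 = real (card (Delta T1 \<inter> T1));
          d2 = real (card (Delta T1 - (T0 \<union> T1)));
          y0 = real (card (Y_set T0 T1 0));
          y3 = real (card (Y_set T0 T1 3));
          \<theta>1 = theta1 T0 T1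
      in (2 * real n ^ 2 - 5 * real n - 4 + \<theta>1) / 3 + 2 * u0 + u1 + 2 * d1 + d2 \<le> y3 \<and>
         y3 \<le> (2 * real n ^ 2 - 2 * real n - 3) / 3 + u0 + u1 + d1 + d2 \<and>
         (real n ^ 2 - 10 * real n - 3) / 3 - u0 - u1 - d1 - d2 + \<theta>1 \<le> y0 \<and>
         y0 \<le> (real n ^ 2 - real n + 1 - \<theta>1) / 3)"
proof -
  interpret based_lee_pair n T0 T1
    using assms(2-9) by unfold_locales
  define t where "t = int (card (T1 \<inter> supp (power_map (T_hat T0 T1) 2))) + 2 * int (card
    ((supp (of_set T1 ^ 2) - (supp (power_map (of_set T1) 2) \<union> {0}))
      \<inter> supp (power_map (T_hat T0 T1) 4)))"
  have t: "2 * theta1 T0 T1 = of_int t"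
    by (simp add: theta1_def t_def)
  \<comment> \<open>All counts were obtained over the integers; they are now coerced to the reals,
    where only divisions by 3 and the relation of \<open>theta1\<close> to \<open>t\<close>
    remain.\<close>
  note X = X_cards(1-4)[THEN arg_cong[where f = real_of_int]]
  note Y = Y_bounds[OF t, THEN of_int_le_iff[where 'a = real, THEN iffD2]]
  show ?thesis
    unfolding Let_def
  proof (intro conjI allI impI)
    show "card (X_set T0 T1 i) = 0" if "i > 3" for i
      using X_cards(5)[OF that] by simp
  qed (use X Y t T0_cubes_location theta0_eq_0 in \<open>simp_all add: field_simps\<close>)
qed

end
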